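(* Let $p$ be a prime with $p\equiv 7\pmod{12}$. Then each of the permutation polynomials $D_{p+2}(1,x)$ and $D_{2p+1}(1,x)$ of $\mathbb{F}_p$ has exactly $\frac{p+1}{2}$ fixed points in $\mathbb{F}_p$.
   Context: The $n$th reversed Dickson polynomial of the first kind (with parameter $1$) is the integer-coefficient polynomial $D_n(1,x)$ defined by $D_0(1,x)=2$, $D_1(1,x)=1$, $D_n(1,x)=D_{n-1}(1,x)-x\,D_{n-2}(1,x)$ for $n\ge 2$ (equivalently, for $n\geq 1$, $D_n(1,x)=\sum_{i=0}^{\lfloor n/2\rfloor}\frac{n}{n-i}\binom{n-i}{i}(-x)^i$). Coefficients are reduced modulo $p$ to regard it as a polynomial over $\mathbb{F}_p$. A permutation polynomial of $\mathbb{F}_p$ is a polynomial whose associated map $\mathbb{F}_p\to\mathbb{F}_p$ is a bijection. A fixed point of $f$ is an element $c\in\mathbb{F}_p$ with $f(c)=c$. *)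

theory Defs
  imports "HOL-Computational_Algebra.Polynomial" "Berlekamp_Zassenhaus.Finite_Field"
begin

text \<open>
  The reversed Dickson polynomials of the first kind with parameter 1, as integer polynomials;
  \<open>[:0, 1:]\<close> is the indeterminate.
\<close>

fun reversed_dickson :: "nat \<Rightarrow> int poly" where
  "reversed_dickson 0 = [:2:]"
| "reversed_dickson (Suc 0) = [:1:]"
| "reversed_dickson (Suc (Suc n)) =
     reversed_dickson (Suc n) - [:0, 1:] * reversed_dickson n"

text \<open>
  The type \<open>'p mod_ring\<close> with \<open>'p :: prime_card\<close> is the prime field with \<open>CARD('p)\<close> elements,
  realised as the integers modulo the prime \<open>CARD('p)\<close>; \<open>of_int\<close> is reduction modulo
  that prime, so \<open>map_poly of_int\<close> reduces the coefficients.
\<close>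

definition reversed_dickson_mod :: "nat \<Rightarrow> 'p::prime_card mod_ring poly" where
  "reversed_dickson_mod n = map_poly of_int (reversed_dickson n)"

definition permutation_poly :: "'a::comm_semiring_0 poly \<Rightarrow> bool" where
  "permutation_poly f \<longleftrightarrow> bij (poly f)"

definition fixed_points :: "'a::comm_semiring_0 poly \<Rightarrow> 'a set" where
  "fixed_points f = {c. poly f c = c}"

end

theory Submission
  imports Defs
begin

text \<open>
  Put \<open>y = (1 + \<delta>)/2\<close> and \<open>z = (1 - \<delta>)/2\<close>.  They sum to 1 and have product \<open>(1 - \<delta>\<^sup>2)/4\<close>, so
  the value of the \<open>n\<close>th reversed Dickson polynomial at \<open>x = (1 - u)/4\<close>, where \<open>u = \<delta>\<^sup>2\<close>, is the
  power sum \<open>y ^ n + z ^ n\<close>.  In characteristic \<open>p\<close> Frobenius turns \<open>y ^ p\<close> into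
  \<open>(1 + \<delta> ^ p)/2\<close>, and for \<open>n = p + 2\<close> or \<open>n = 2 * p + 1\<close> the power sum collapses to
  \<open>(1 + u + 2 * u * \<eta>(u))/4\<close> with \<open>\<eta>(u) = u ^ ((p - 1) div 2)\<close>: for \<open>2 * p + 1\<close> one first finds
  \<open>u ^ p\<close> in place of \<open>u\<close>, which is the same element of the prime field.  Taking \<open>\<delta>\<close> to be a
  polynomial variable, and cancelling the substitution \<open>u = \<delta>\<^sup>2\<close> at the end, replaces an
  extension field in which \<open>u\<close> has a square root.

  For nonzero \<open>u\<close> the quadratic character \<open>\<eta>(u)\<close> is 1 or -1, so in the coordinate \<open>u\<close> both
  polynomials act as the map that multiplies the nonzero squares by \<open>-3\<close> and fixes everything
  else (\<open>reversed_dickson_mod_eq_twist\<close>).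
  Since \<open>p\<close> is 1 modulo 3, there is a primitive cube root of unity \<open>w\<close>, and \<open>-3 = (2 * w + 1)\<^sup>2\<close>
  is a square (\<open>minus_3_power_eq_1\<close>).  Multiplication by \<open>-3\<close> therefore permutes the nonzero
  squares, and it moves each of them because \<open>-3\<close> is not 1.  The fixed points are the non-squares
  and 0, and there are \<open>(p - 1)/2 + 1\<close> of these.
\<close>

section \<open>Roots of unity in finite fields\<close>

lemma finite_field_power_card_minus_1:
  fixes x :: "'a::finite_field"
  assumes "x \<noteq> 0"
  shows "x ^ (CARD('a) - 1) = 1"
proof -
  have "x * x ^ (CARD('a) - 1) = x ^ CARD('a)"
    by (metis power_eq_if zero_less_card_finite less_numeral_extra(3))
  also have "\<dots> = x * 1"
    by (simp add: finite_field_power_card_eq_same)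
  finally show ?thesis
    using assms by simp
qed

text \<open>
  With \<open>CARD('a) - 1 = d * m\<close>, the polynomial \<open>X ^ (d * m) - 1\<close> factors as \<open>X ^ d - 1\<close> times a
  geometric sum of degree \<open>d * (m - 1)\<close>.  Its \<open>d * m\<close> roots must be shared between the two
  factors, so each factor has as many roots as its degree allows.
\<close>
lemma card_roots_of_unity_finite_field:
  assumes "d dvd CARD('a::finite_field) - 1"
  shows "card {x::'a. x ^ d = 1} = d"
proof -
  from assms obtain m where m: "CARD('a) - 1 = d * m"
    by (auto simp: dvd_def)
  have "CARD('a) > 1"
    using card_mono[of "UNIV :: 'a set" "{0, 1}"] by simp
  with m have dm: "d > 0" "m > 0"
    by (auto intro!: gr0I)
  define f :: "'a poly" where "f = monom 1 d - 1"
  define g :: "'a poly" where "g = (\<Sum>i<m. monom 1 (d * i))"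
  have f: "poly f x = x ^ d - 1" for x
    by (simp add: f_def poly_monom)
  have g: "poly g x = (\<Sum>i<m. (x ^ d) ^ i)" for x
    by (simp add: g_def poly_sum poly_monom power_mult)
  have "coeff f d = 1" "coeff g 0 = 1"
    using dm by (simp_all add: f_def g_def coeff_sum)
  then have nz: "f \<noteq> 0" "g \<noteq> 0"
    by auto
  have "degree f \<le> d"
    by (simp add: f_def degree_diff_le degree_monom_le)
  with card_poly_roots_bound[OF nz(1)] have card_f: "card {x. poly f x = 0} \<le> d"
    by linarith
  have "degree g \<le> d * (m - 1)"
    unfolding g_def
    by (intro degree_sum_le) (auto intro!: order.trans[OF degree_monom_le])
  with card_poly_roots_bound[OF nz(2)] have card_g: "card {x. poly g x = 0} \<le> d * (m - 1)"
    by linarith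
  have "- {0} \<subseteq> {x. poly f x = 0} \<union> {x. poly g x = 0}"
  proof
    fix x :: 'a
    assume "x \<in> - {0}"
    then have "x ^ (CARD('a) - 1) = 1"
      by (intro finite_field_power_card_minus_1) simp
    then have "(x ^ d) ^ m = 1"
      unfolding m power_mult .
    then have "(x ^ d - 1) * (\<Sum>i<m. (x ^ d) ^ i) = 0"
      by (simp add: power_diff_1_eq[symmetric])
    then show "x \<in> {x. poly f x = 0} \<union> {x. poly g x = 0}"
      by (simp add: f g)
  qed
  then have "card (- {0 :: 'a}) \<le> card {x. poly f x = 0} + card {x. poly g x = 0}"
    by (intro order.trans[OF card_mono card_Un_le]) auto
  then have "d * m \<le> card {x. poly f x = 0} + card {x. poly g x = 0}"
    by (simp add: Compl_eq_Diff_UNIV flip: m)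
  moreover have "d * m = d + d * (m - 1)"
    using dm by (cases m) simp_all
  ultimately have "card {x. poly f x = 0} = d"
    using card_f card_g by linarith
  then show ?thesis
    by (simp add: f)
qed

text \<open>
  A primitive cube root of unity \<open>w\<close> satisfies \<open>w\<^sup>2 + w + 1 = 0\<close>, hence \<open>(2 * w + 1)\<^sup>2 = -3\<close>.
\<close>
lemma minus_3_square:
  assumes "3 dvd CARD('a::finite_field) - 1"
  obtains r :: "'a::finite_field" where "r \<noteq> 0" "r\<^sup>2 = -3"
proof -
  have "\<not> {x::'a. x ^ 3 = 1} \<subseteq> {1}"
    using card_roots_of_unity_finite_field[OF assms] card_mono[of "{1::'a}" "{x. x ^ 3 = 1}"]
    by auto
  then obtain w :: 'a where w: "w ^ 3 = 1" "w \<noteq> 1"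
    by auto
  have "(w - 1) * (w\<^sup>2 + w + 1) = w ^ 3 - 1"
    by (simp add: algebra_simps power2_eq_square power3_eq_cube)
  with w have eq: "w\<^sup>2 + w + 1 = 0"
    by simp
  have "(2 * w + 1)\<^sup>2 = 4 * (w\<^sup>2 + w + 1) - 3"
    by (simp add: algebra_simps power2_eq_square)
  with eq have sq: "(2 * w + 1)\<^sup>2 = -3"
    by simp
  \<comment> \<open>In characteristic 3, \<open>w\<^sup>2 + w + 1 = (w - 1)\<^sup>2\<close>, whose only root is the excluded \<open>w = 1\<close>.\<close>
  have "2 * w + 1 \<noteq> 0"
  proof
    assume "2 * w + 1 = 0"
    with sq have "(3::'a) = 0"
      by simp
    moreover have "(w - 1)\<^sup>2 = (w\<^sup>2 + w + 1) - 3 * w"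
      by (simp add: algebra_simps power2_eq_square)
    ultimately have "(w - 1)\<^sup>2 = 0"
      using eq by simp
    with w show False
      by simp
  qed
  with sq show ?thesis
    using that by blast
qed

lemma minus_3_power_eq_1:
  assumes "3 dvd CARD('a::finite_field) - 1" and "odd CARD('a)"
  shows "(-3 :: 'a) ^ ((CARD('a) - 1) div 2) = 1"
proof -
  obtain r :: 'a where r: "r \<noteq> 0" "r\<^sup>2 = -3"
    using minus_3_square[OF assms(1)] .
  have "(-3 :: 'a) ^ ((CARD('a) - 1) div 2) = r ^ (2 * ((CARD('a) - 1) div 2))"
    by (simp add: r(2) power_mult)
  also have "\<dots> = 1"
    using assms(2) finite_field_power_card_minus_1[OF r(1)] by simp
  finally show ?thesis .
qed

lemma half_power_cases:
  fixes u :: "'a::finite_field"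
  assumes "odd CARD('a)" "u \<noteq> 0"
  shows "u ^ ((CARD('a) - 1) div 2) = 1 \<or> u ^ ((CARD('a) - 1) div 2) = -1"
proof -
  have "(u ^ ((CARD('a) - 1) div 2))\<^sup>2 = u ^ (CARD('a) - 1)"
    using assms(1) by (simp flip: power_mult)
  also have "\<dots> = 1"
    by (rule finite_field_power_card_minus_1) fact
  finally show ?thesis
    by (simp add: power2_eq_1_iff)
qed

section \<open>Multiplying the roots of unity by one of them\<close>

text \<open>For odd \<open>q\<close> and \<open>h = (q - 1) div 2\<close>, the roots of unity involved are the nonzero squares
  of the field with \<open>q\<close> elements.\<close>
definition twist :: "nat \<Rightarrow> 'a \<Rightarrow> 'a \<Rightarrow> 'a::field" where
  "twist h a u = (if u ^ h = 1 then a * u else u)"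

text \<open>The power \<open>u ^ h\<close> is unchanged by the map, so it tells which branch produced a value.\<close>
lemma inj_twist:
  assumes "a ^ h = 1" "a \<noteq> 0"
  shows "inj (twist h a)"
proof
  fix u v assume eq: "twist h a u = twist h a v"
  have "twist h a w ^ h = w ^ h" for w
    using assms by (simp add: twist_def power_mult_distrib)
  with eq have "u ^ h = v ^ h"
    by metis
  with eq assms(2) show "u = v"
    by (simp add: twist_def split: if_splits)
qed

lemma twist_eq_self_iff:
  assumes "h > 0" "a \<noteq> 1"
  shows "twist h a u = u \<longleftrightarrow> u ^ h \<noteq> 1"
proof (cases "u ^ h = 1")
  case True
  with assms(1) have "u \<noteq> 0"
    by (metis power_0_left less_irrefl zero_neq_one)
  with True assms(2) show ?thesis
    by (simp add: twist_def)
qed (simp add: twist_def)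

section \<open>Reversed Dickson polynomials in characteristic p\<close>

lemma reversed_dickson_mod_simps:
  "reversed_dickson_mod 0 = (2 :: 'p::prime_card mod_ring poly)"
  "reversed_dickson_mod (Suc 0) = (1 :: 'p mod_ring poly)"
  "reversed_dickson_mod (Suc (Suc n)) =
     (reversed_dickson_mod (Suc n) - [:0, 1:] * reversed_dickson_mod n :: 'p mod_ring poly)"
  by (simp_all add: reversed_dickson_mod_def numeral_poly one_pCons
      of_int_hom.map_poly_pCons_hom of_int_poly_hom.hom_minus)

text \<open>
  The power sums of \<open>y\<close> and \<open>z\<close> obey the recurrence with characteristic polynomial
  \<open>(t - y) * (t - z)\<close>, which is the Dickson recurrence when \<open>y + z = 1\<close>.
\<close>
lemma pcompose_reversed_dickson_mod:
  fixes y z :: "'p::prime_card mod_ring poly"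
  assumes "y + z = 1"
  shows "pcompose (reversed_dickson_mod n) (y * z) = y ^ n + z ^ n"
proof (induction n rule: reversed_dickson.induct)
  case 1
  then show ?case
    by (simp add: reversed_dickson_mod_simps numeral_poly)
next
  case 2
  then show ?case
    by (simp add: reversed_dickson_mod_simps assms)
next
  case (3 n)
  have "y ^ Suc (Suc n) + z ^ Suc (Suc n) =
      (y + z) * (y ^ Suc n + z ^ Suc n) - y * z * (y ^ n + z ^ n)"
    by (simp add: algebra_simps)
  with 3 assms show ?case
    by (simp add: reversed_dickson_mod_simps pcompose_diff pcompose_mult)
qed

lemma pcompose_power: "pcompose (f ^ n) g = pcompose f g ^ n"
  for f g :: "'a::comm_semiring_1 poly"
  by (induction n) (simp_all add: pcompose_mult)

lemma mod_ring_numeral_neq_0: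
  assumes "odd CARD('p::prime_card)"
  shows "(2 :: 'p mod_ring) \<noteq> 0" "(4 :: 'p mod_ring) \<noteq> 0"
proof -
  have "\<not> CARD('p) dvd 2"
    using assms primes_dvd_imp_eq[OF prime_card[where 'a = 'p] two_is_prime_nat] by auto
  then show two: "(2 :: 'p mod_ring) \<noteq> 0"
    using of_nat_eq_0_iff_char_dvd[of 2, where 'a = "'p mod_ring"] by simp
  have "(4 :: 'p mod_ring) = 2 * 2"
    by simp
  with two show "(4 :: 'p mod_ring) \<noteq> 0"
    by (metis mult_eq_0_iff)
qed

text \<open>
  As \<open>c = 1/2\<close>, the inner polynomial is \<open>(1 - u)/4\<close> in the variable \<open>u\<close>.  Put \<open>\<delta> = X\<close>,
  \<open>W = X ^ p\<close>, \<open>y = (1 + X)/2\<close> and \<open>z = (1 - X)/2\<close>; Frobenius gives \<open>y ^ p = (1 + W)/2\<close> and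
  \<open>z ^ p = (1 - W)/2\<close>.  The power sums of \<open>y\<close> and \<open>z\<close> are then polynomials in \<open>X\<^sup>2\<close>, and the
  substitution \<open>u = X\<^sup>2\<close> can be cancelled because it is injective on polynomials.
\<close>
lemma reversed_dickson_mod_in_discriminant:
  fixes c :: "'p::prime_card mod_ring"
  assumes "odd CARD('p)" and c: "2 * c = 1"
  defines "X \<equiv> [:0, 1:] :: 'p mod_ring poly" and "h \<equiv> (CARD('p) - 1) div 2"
  shows "pcompose (reversed_dickson_mod (CARD('p) + 2)) [:c\<^sup>2, - c\<^sup>2:] =
           smult (c\<^sup>2) (1 + X + 2 * X ^ Suc h)"
    and "pcompose (reversed_dickson_mod (2 * CARD('p) + 1)) [:c\<^sup>2, - c\<^sup>2:] =
           smult (c\<^sup>2) (1 + X ^ CARD('p) + 2 * X ^ Suc h)"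
proof -
  define C where "C = [:c:]"
  define W where "W = X ^ CARD('p)"
  define y where "y = C * (1 + X)"
  define z where "z = C * (1 - X)"
  have p: "CARD('p) = 2 * h + 1"
    using assms(1) by (auto simp: h_def elim: oddE)
  have C: "2 * C = 1"
    using c by (simp add: C_def numeral_poly one_pCons mult.commute)
  have "y + z = 2 * C"
    by (simp add: y_def z_def algebra_simps)
  with C have yz: "y + z = 1"
    by simp
  have prod: "y * z = pcompose [:c\<^sup>2, - c\<^sup>2:] (X\<^sup>2)"
    by (simp add: y_def z_def C_def X_def power2_eq_square one_pCons)
  have frob: "(f + g) ^ CARD('p) = f ^ CARD('p) + g ^ CARD('p)" for f g :: "'p mod_ring poly"
    by (rule freshmans_dream) (simp_all add: prime_card)
  have "c ^ CARD('p) = c"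
    using finite_field_power_card_eq_same[of c] by simp
  then have "C ^ CARD('p) = C"
    by (simp add: C_def poly_const_pow)
  then have y_pow: "y ^ CARD('p) = C * (1 + W)"
    by (simp add: y_def W_def power_mult_distrib frob)
  have "y ^ CARD('p) + z ^ CARD('p) = 1"
    using frob[of y z] yz by simp
  then have "z ^ CARD('p) = 2 * C - C * (1 + W)"
    using y_pow C by (simp add: algebra_simps)
  then have z_pow: "z ^ CARD('p) = C * (1 - W)"
    by (simp add: algebra_simps)
  have XW: "X * W = (X\<^sup>2) ^ Suc h"
    unfolding W_def p by (simp add: power_mult[symmetric] flip: power_Suc)
  have W2: "W\<^sup>2 = (X\<^sup>2) ^ CARD('p)"
    unfolding W_def by (simp add: power_mult[symmetric] mult.commute)
  have smult_C: "smult (c\<^sup>2) f = C\<^sup>2 * f" for f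
    by (simp add: C_def power2_eq_square)
  have X_o: "pcompose X (X\<^sup>2) = X\<^sup>2"
    by (simp add: X_def)
  have deg: "degree (X\<^sup>2) > 0"
    by (simp add: X_def power2_eq_square)
  have cancel: "pcompose f (X\<^sup>2) = pcompose g (X\<^sup>2) \<Longrightarrow> f = g" for f g
    using pcompose_eq_0[OF _ deg, of "f - g"] by (simp add: pcompose_diff)
  note pcomp = pcompose_assoc[symmetric] prod[symmetric] pcompose_reversed_dickson_mod[OF yz]
    pcompose_smult pcompose_add pcompose_mult pcompose_power pcompose_1 X_o numeral_poly

  show "pcompose (reversed_dickson_mod (CARD('p) + 2)) [:c\<^sup>2, - c\<^sup>2:] =
           smult (c\<^sup>2) (1 + X + 2 * X ^ Suc h)"
  proof (rule cancel)
    have "y ^ (CARD('p) + 2) + z ^ (CARD('p) + 2) =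
        C * (1 + W) * (C * (1 + X))\<^sup>2 + C * (1 - W) * (C * (1 - X))\<^sup>2"
      unfolding power_add y_pow z_pow by (simp only: y_def z_def)
    also have "\<dots> = 2 * C * (C\<^sup>2 * (1 + X\<^sup>2 + 2 * (X * W)))"
      by (simp add: algebra_simps power2_eq_square)
    also have "\<dots> = smult (c\<^sup>2) (1 + X\<^sup>2 + 2 * (X\<^sup>2) ^ Suc h)"
      by (simp only: C XW smult_C mult_1_left)
    finally show "pcompose (pcompose (reversed_dickson_mod (CARD('p) + 2)) [:c\<^sup>2, - c\<^sup>2:]) (X\<^sup>2) =
        pcompose (smult (c\<^sup>2) (1 + X + 2 * X ^ Suc h)) (X\<^sup>2)"
      by (simp only: pcomp pcompose_const)
  qed

  show "pcompose (reversed_dickson_mod (2 * CARD('p) + 1)) [:c\<^sup>2, - c\<^sup>2:] =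
           smult (c\<^sup>2) (1 + X ^ CARD('p) + 2 * X ^ Suc h)"
  proof (rule cancel)
    have "y ^ (2 * CARD('p) + 1) + z ^ (2 * CARD('p) + 1) =
        (C * (1 + W))\<^sup>2 * (C * (1 + X)) + (C * (1 - W))\<^sup>2 * (C * (1 - X))"
      unfolding power_add mult.commute[of 2] power_mult y_pow z_pow
      by (simp only: y_def z_def power_one_right)
    also have "\<dots> = 2 * C * (C\<^sup>2 * (1 + W\<^sup>2 + 2 * (X * W)))"
      by (simp add: algebra_simps power2_eq_square)
    also have "\<dots> = smult (c\<^sup>2) (1 + (X\<^sup>2) ^ CARD('p) + 2 * (X\<^sup>2) ^ Suc h)"
      by (simp only: C XW W2 smult_C mult_1_left)
    finally show "pcompose (pcompose (reversed_dickson_mod (2 * CARD('p) + 1)) [:c\<^sup>2, - c\<^sup>2:]) (X\<^sup>2) =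
        pcompose (smult (c\<^sup>2) (1 + X ^ CARD('p) + 2 * X ^ Suc h)) (X\<^sup>2)"
      by (simp only: pcomp pcompose_const)
  qed
qed

text \<open>
  If \<open>u ^ h = 1\<close>, the value \<open>(1 + u + 2 * u * u ^ h)/4\<close> is \<open>(1 + 3 * u)/4\<close>; if \<open>u\<close> is 0 or
  \<open>u ^ h = -1\<close>, it is \<open>(1 - u)/4 = x\<close>.
\<close>
lemma reversed_dickson_mod_eq_twist:
  fixes x :: "'p::prime_card mod_ring"
  assumes odd: "odd CARD('p)" and n: "n = CARD('p) + 2 \<or> n = 2 * CARD('p) + 1"
  shows "4 * poly (reversed_dickson_mod n) x = 1 - twist ((CARD('p) - 1) div 2) (- 3) (1 - 4 * x)"
proof -
  define h where "h = (CARD('p) - 1) div 2"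
  define u where "u = 1 - 4 * x"
  define c :: "'p mod_ring" where "c = 1 / 2"
  have c: "2 * c = 1"
    using mod_ring_numeral_neq_0(1)[OF odd] by (simp add: c_def)
  have "4 * c\<^sup>2 = (2 * c) * (2 * c)"
    by (simp add: power2_eq_square)
  with c have c2: "4 * c\<^sup>2 = 1"
    by simp
  have "poly [:c\<^sup>2, - c\<^sup>2:] u = 4 * c\<^sup>2 * x"
    by (simp add: u_def algebra_simps)
  with c2 have x: "x = poly [:c\<^sup>2, - c\<^sup>2:] u"
    by simp
  have "u ^ CARD('p) = u"
    using finite_field_power_card_eq_same[of u] by simp
  then have "poly (pcompose (reversed_dickson_mod n) [:c\<^sup>2, - c\<^sup>2:]) u = c\<^sup>2 * (1 + u + 2 * u ^ Suc h)"
    using n reversed_dickson_mod_in_discriminant[OF odd c, folded h_def] by auto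
  then have "4 * poly (reversed_dickson_mod n) x = 4 * c\<^sup>2 * (1 + u + 2 * u ^ Suc h)"
    unfolding poly_pcompose x[symmetric] by (simp only: mult.assoc)
  then have val: "4 * poly (reversed_dickson_mod n) x = 1 + u + 2 * (u * u ^ h)"
    by (simp add: c2)
  have neq: "(1 :: 'p mod_ring) \<noteq> -1"
    using mod_ring_numeral_neq_0(1)[OF odd] by (simp add: eq_neg_iff_add_eq_0)
  have "u = 0 \<or> u ^ h = 1 \<or> u ^ h = -1"
    using half_power_cases[of u] odd by (auto simp: h_def)
  then have "1 + u + 2 * (u * u ^ h) = 1 - twist h (- 3) u"
    using neq by (auto simp: twist_def)
  with val show ?thesis
    by (simp only: h_def u_def)
qed

section \<open>Permutation property and fixed points\<close>

lemma permutation_poly_reversed_dickson_mod: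
  assumes "odd CARD('p::prime_card)" "3 dvd CARD('p) - 1"
    and "n = CARD('p) + 2 \<or> n = 2 * CARD('p) + 1"
  shows "permutation_poly (reversed_dickson_mod n :: 'p mod_ring poly)"
proof -
  let ?h = "(CARD('p) - 1) div 2"
  have one: "(-3 :: 'p mod_ring) ^ ?h = 1"
    using minus_3_power_eq_1[where 'a = "'p mod_ring"] assms by simp
  obtain r :: "'p mod_ring" where "r \<noteq> 0" "r\<^sup>2 = -3"
    using minus_3_square[where 'a = "'p mod_ring"] assms by auto
  then have "(-3 :: 'p mod_ring) \<noteq> 0"
    by (metis power_not_zero)
  with one have inj: "inj (twist ?h (-3 :: 'p mod_ring))"
    by (rule inj_twist)
  have "inj (poly (reversed_dickson_mod n :: 'p mod_ring poly))"
  proof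
    fix x y :: "'p mod_ring"
    assume "poly (reversed_dickson_mod n) x = poly (reversed_dickson_mod n) y"
    then have "1 - twist ?h (-3) (1 - 4 * x) = 1 - twist ?h (-3) (1 - 4 * y)"
      unfolding reversed_dickson_mod_eq_twist[OF assms(1,3), symmetric] by simp
    then have "1 - 4 * x = 1 - 4 * y"
      using inj by (simp add: inj_eq)
    then show "x = y"
      using mod_ring_numeral_neq_0(2)[OF assms(1)] by simp
  qed
  then show ?thesis
    by (simp add: permutation_poly_def bij_def finite_UNIV_inj_surj)
qed

text \<open>
  In the coordinate \<open>u = 1 - 4 * x\<close> the fixed points are the \<open>u\<close> with \<open>u ^ ((p - 1) div 2) \<noteq> 1\<close>,
  the complement of a set of \<open>(p - 1) div 2\<close> roots of unity.
\<close>
lemma card_fixed_points_reversed_dickson_mod: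
  assumes odd: "odd CARD('p::prime_card)"
    and "n = CARD('p) + 2 \<or> n = 2 * CARD('p) + 1"
  shows "card (fixed_points (reversed_dickson_mod n :: 'p mod_ring poly)) = (CARD('p) + 1) div 2"
proof -
  define h where "h = (CARD('p) - 1) div 2"
  let ?F = "fixed_points (reversed_dickson_mod n :: 'p mod_ring poly)"
  note four = mod_ring_numeral_neq_0(2)[OF odd]
  have p: "CARD('p) = 2 * h + 1"
    using odd by (auto simp: h_def elim: oddE)
  have "CARD('p) > 1"
    by (rule nontriv)
  with p have "h > 0"
    by simp
  have "(-3 :: 'p mod_ring) \<noteq> 1"
    using four by (simp add: neg_eq_iff_add_eq_0)
  have fixed_iff: "x \<in> ?F \<longleftrightarrow> (1 - 4 * x) ^ h \<noteq> 1" for x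
  proof -
    have "x \<in> ?F \<longleftrightarrow> 4 * poly (reversed_dickson_mod n) x = 4 * x"
      using four by (simp add: fixed_points_def)
    also have "\<dots> \<longleftrightarrow> twist h (-3) (1 - 4 * x) = 1 - 4 * x"
      unfolding reversed_dickson_mod_eq_twist[OF assms] h_def by (auto simp: algebra_simps)
    also have "\<dots> \<longleftrightarrow> (1 - 4 * x) ^ h \<noteq> 1"
      by (rule twist_eq_self_iff) fact+
    finally show ?thesis .
  qed
  have "bij_betw (\<lambda>x. 1 - 4 * x) ?F (- {u. u ^ h = 1})"
    by (rule bij_betw_byWitness[where f' = "\<lambda>u. (1 - u) / 4"]) (use four in \<open>auto simp: fixed_iff\<close>)
  then have "card ?F = card (- {u :: 'p mod_ring. u ^ h = 1})"
    by (rule bij_betw_same_card)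
  also have "\<dots> = CARD('p) - h"
    using card_roots_of_unity_finite_field[of h, where 'a = "'p mod_ring"] p
    by (simp add: Compl_eq_Diff_UNIV card_Diff_subset)
  finally show ?thesis
    using p by simp
qed

theorem theorem3p8:
  fixes p :: nat
  assumes "prime p"
    and "p mod 12 = 7"
    and "CARD('p::prime_card) = p"
  shows "permutation_poly (reversed_dickson_mod (p + 2) :: 'p mod_ring poly)
       \<and> card (fixed_points (reversed_dickson_mod (p + 2) :: 'p mod_ring poly)) = (p + 1) div 2
       \<and> permutation_poly (reversed_dickson_mod (2 * p + 1) :: 'p mod_ring poly)
       \<and> card (fixed_points (reversed_dickson_mod (2 * p + 1) :: 'p mod_ring poly)) = (p + 1) div 2"
proof -
  have "odd p" "3 dvd p - 1"
    using assms(2) by presburger+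
  then show ?thesis
    using permutation_poly_reversed_dickson_mod[where 'p = 'p]
      card_fixed_points_reversed_dickson_mod[where 'p = 'p]
    by (simp add: assms(3))
qed

end
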